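(* Let $\alpha_k\ge0$, $k\in\mathbb{N}_0$, with $K:=\sum_{k=1}^\infty\alpha_k<1$, and let $(X_n)_{n\in\mathbb{Z}}$ be the stationary INAR($\infty$) process with immigration parameter $\alpha_0$ and reproduction coefficients $\alpha_k$, $k\in\mathbb{N}$. Let $\mu_X:=\mathbb{E}X_0=\alpha_0/(1-K)$ and $$u_n:=X_n-\sum_{k=1}^\infty\alpha_kX_{n-k}-\alpha_0,\qquad n\in\mathbb{Z}.$$ Define $\beta_0:=1$ and $\beta_k:=\sum_{i=1}^k\alpha_i\beta_{k-i}$, $k\in\mathbb{N}$. Then $$X_n-\mu_X=\sum_{k=0}^\infty\beta_ku_{n-k},\qquad n\in\mathbb{Z}.$$ Furthermore, $\beta_k\ge0$, $k\in\mathbb{N}_0$, and $\sum_{k=0}^\infty\beta_k=1/(1-K)<\infty$.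
   Context: INAR($\infty$): Given $\alpha_k\ge0$ ($k\in\mathbb{N}_0$) with $K=\sum_{k\ge1}\alpha_k<1$, let $\varepsilon_n$, $n\in\mathbb{Z}$, be i.i.d. $\mathrm{Pois}(\alpha_0)$ and $\xi^{(n,k)}_l\sim\mathrm{Pois}(\alpha_k)$ independently over $n\in\mathbb{Z}$, $k,l\in\mathbb{N}$ and independent of $(\varepsilon_n)$. The INAR($\infty$) process with immigration parameter $\alpha_0$ and reproduction coefficients $\alpha_k$, $k\in\mathbb{N}$, is the almost surely unique (strictly) stationary $\mathbb{N}_0$-valued solution $(X_n)_{n\in\mathbb{Z}}$ of $X_n=\varepsilon_n+\sum_{k=1}^\infty\sum_{l=1}^{X_{n-k}}\xi^{(n,k)}_l$, $n\in\mathbb{Z}$, where $\varepsilon_n$ and $(\xi^{(n,k)}_l)_{k,l}$ are independent of $X_{n-1},X_{n-2},\dots$. It satisfies $\mathbb{E}X_n=\alpha_0/(1-K)$. The sequence $(u_n)$ is a stationary white-noise sequence (mean zero, uncorrelated, variance $\alpha_0/(1-K)$). Equalities of random variables are almost sure. *)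

theory Defs
  imports "HOL-Probability.Probability"
begin

text \<open>The library's \<^term>\<open>poisson_pmf\<close> is only specified for positive rates; the Poisson
  law with rate 0 is the point mass at 0.\<close>

definition pois :: "real \<Rightarrow> nat pmf" where
  "pois r = (if r = 0 then return_pmf 0 else poisson_pmf r)"

datatype noise_index = Immigration int | Offspring int nat nat

definition noise_indices :: "noise_index set" where
  "noise_indices = range Immigration \<union> {Offspring n k l | n k l. 1 \<le> k \<and> 1 \<le> l}"

fun noise :: "(int \<Rightarrow> 'w \<Rightarrow> nat) \<Rightarrow> (int \<Rightarrow> nat \<Rightarrow> nat \<Rightarrow> 'w \<Rightarrow> nat) \<Rightarrow> noise_index \<Rightarrow> 'w \<Rightarrow> nat" where
  "noise \<epsilon> \<xi> (Immigration n) = \<epsilon> n"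
| "noise \<epsilon> \<xi> (Offspring n k l) = \<xi> n k l"

context prob_space
begin

text \<open>Here \<open>\<xi> n k l\<close> stands for the \<open>l\<close>-th copy at time \<open>n\<close> and lag \<open>k\<close> and only matters for \<open>k, l \<ge> 1\<close>. That the
  \<open>\<epsilon> n\<close> are independent, the \<open>\<xi> n k l\<close> are independent, and the two families are independent of each
  other is expressed as mutual independence of the combined family.\<close>

definition inar_noise ::
  "(nat \<Rightarrow> real) \<Rightarrow> (int \<Rightarrow> 'a \<Rightarrow> nat) \<Rightarrow> (int \<Rightarrow> nat \<Rightarrow> nat \<Rightarrow> 'a \<Rightarrow> nat) \<Rightarrow> bool" where
  "inar_noise \<alpha> \<epsilon> \<xi> \<longleftrightarrow>
     indep_vars (\<lambda>_. count_space UNIV) (noise \<epsilon> \<xi>) noise_indices \<and>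
     (\<forall>n. distr M (count_space UNIV) (\<epsilon> n) = measure_pmf (pois (\<alpha> 0))) \<and>
     (\<forall>n. \<forall>k\<ge>1. \<forall>l\<ge>1. distr M (count_space UNIV) (\<xi> n k l) = measure_pmf (pois (\<alpha> k)))"

definition strictly_stationary :: "(int \<Rightarrow> 'a \<Rightarrow> nat) \<Rightarrow> bool" where
  "strictly_stationary X \<longleftrightarrow>
     (\<forall>n. random_variable (count_space UNIV) (X n)) \<and>
     (\<forall>h. distr M (PiM UNIV (\<lambda>_. count_space UNIV)) (\<lambda>\<omega> n. X (n + h) \<omega>) =
          distr M (PiM UNIV (\<lambda>_. count_space UNIV)) (\<lambda>\<omega> n. X n \<omega>))"

text \<open>Convergence of the series over \<open>k\<close> is part of the recursion. The last conjunct
  says that the \<open>\<sigma>\<close>-algebra generated by \<open>\<epsilon> n\<close> and all \<open>\<xi> n k l\<close> is independent of the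
  one generated by the whole past \<open>X m\<close>, \<open>m < n\<close>.\<close>

definition stationary_inar_solution ::
  "(int \<Rightarrow> 'a \<Rightarrow> nat) \<Rightarrow> (int \<Rightarrow> nat \<Rightarrow> nat \<Rightarrow> 'a \<Rightarrow> nat) \<Rightarrow> (int \<Rightarrow> 'a \<Rightarrow> nat) \<Rightarrow> bool" where
  "stationary_inar_solution \<epsilon> \<xi> X \<longleftrightarrow>
     strictly_stationary X \<and>
     (\<forall>n. AE \<omega> in M.
        ((\<lambda>k. real (\<Sum>l = 1..X (n - int k) \<omega>. \<xi> n k l \<omega>)) has_sum
           (real (X n \<omega>) - real (\<epsilon> n \<omega>))) {1..}) \<and>
     (\<forall>n. indep_set
        (sets (vimage_algebra (space M)
          (\<lambda>\<omega>. (\<epsilon> n \<omega>, restrict (\<lambda>(k, l). \<xi> n k l \<omega>) ({1..} \<times> {1..})))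
          (count_space UNIV \<Otimes>\<^sub>M PiM ({1..} \<times> {1..}) (\<lambda>_. count_space UNIV))))
        (sets (vimage_algebra (space M)
          (\<lambda>\<omega>. restrict (\<lambda>m. X m \<omega>) {..<n})
          (PiM {..<n} (\<lambda>_. count_space UNIV)))))"

text \<open>``The almost surely unique stationary solution'' is a definite description: \<open>X\<close> is a
  solution, and any other solution driven by the same noise agrees with it almost surely. Finiteness
  of the mean is not part of the definition.\<close>

definition inar_process ::
  "(nat \<Rightarrow> real) \<Rightarrow> (int \<Rightarrow> 'a \<Rightarrow> nat) \<Rightarrow> (int \<Rightarrow> nat \<Rightarrow> nat \<Rightarrow> 'a \<Rightarrow> nat) \<Rightarrow> (int \<Rightarrow> 'a \<Rightarrow> nat) \<Rightarrow> bool" where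
  "inar_process \<alpha> \<epsilon> \<xi> X \<longleftrightarrow>
     inar_noise \<alpha> \<epsilon> \<xi> \<and>
     stationary_inar_solution \<epsilon> \<xi> X \<and>
     (\<forall>Y. stationary_inar_solution \<epsilon> \<xi> Y \<longrightarrow> (AE \<omega> in M. \<forall>n. Y n \<omega> = X n \<omega>))"

end

text \<open>If the series diverged, \<^const>\<open>suminf\<close> would be meaningless here; it converges almost
  surely as soon as \<open>X\<close> has constant finite mean.\<close>

definition inar_innovation :: "(nat \<Rightarrow> real) \<Rightarrow> (int \<Rightarrow> 'w \<Rightarrow> nat) \<Rightarrow> int \<Rightarrow> 'w \<Rightarrow> real" where
  "inar_innovation \<alpha> X n \<omega> =
     real (X n \<omega>) - (\<Sum>k. \<alpha> (Suc k) * real (X (n - int (Suc k)) \<omega>)) - \<alpha> 0"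

fun inar_beta :: "(nat \<Rightarrow> real) \<Rightarrow> nat \<Rightarrow> real" where
  "inar_beta \<alpha> 0 = 1"
| "inar_beta \<alpha> (Suc k) = (\<Sum>i = 1..Suc k. \<alpha> i * inar_beta \<alpha> (Suc k - i))"

end

theory Submission
  imports Defs
begin

text \<open>Finiteness of the mean is not part of the definition of the process, so it is obtained from
  uniqueness. Iterating the recursion from \<open>0\<close> yields an increasing sequence of functionals of the
  noise; since generation \<open>m\<close> at time \<open>n - k\<close> depends only on noise strictly before time \<open>n\<close>, Wald's
  identity gives its mean \<open>\<alpha>\<^sub>0 (1 + K + \<dots> + K\<^sup>m\<^sup>-\<^sup>1)\<close>. The limit is therefore almost surely finite with
  mean \<open>\<alpha>\<^sub>0 / (1 - K)\<close>. It solves the recursion, it commutes with time shifts of the noise and is hence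
  stationary, and its past is a function of the past noise; by uniqueness it equals \<open>X\<close>. Given the
  finite mean, all series converge absolutely almost surely, and the expansion in the innovations
  is the identity \<open>\<beta>\<^sub>m = \<Sum>\<^sub>j \<alpha>\<^sub>j \<beta>\<^bsub>m-j\<^esub>\<close> applied to a rearranged double series.\<close>

section \<open>The moving average coefficients\<close>

lemma inar_beta_Suc: "inar_beta \<alpha> (Suc k) = (\<Sum>i\<le>k. \<alpha> (Suc i) * inar_beta \<alpha> (k - i))"
proof -
  have "inar_beta \<alpha> (Suc k) = (\<Sum>i\<in>Suc ` {..k}. \<alpha> i * inar_beta \<alpha> (Suc k - i))"
    by (simp add: image_Suc_atMost)
  also have "\<dots> = (\<Sum>i\<le>k. \<alpha> (Suc i) * inar_beta \<alpha> (k - i))"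
    by (subst sum.reindex) auto
  finally show ?thesis .
qed

lemma inar_beta_nonneg:
  assumes "\<And>k. \<alpha> k \<ge> 0"
  shows "inar_beta \<alpha> k \<ge> 0"
proof (induction k rule: less_induct)
  case (less k)
  show ?case
  proof (cases k)
    case (Suc m)
    then show ?thesis
      using less assms by (auto simp: inar_beta_Suc simp del: inar_beta.simps intro!: sum_nonneg)
  qed simp
qed

text \<open>Enlarging the triangle \<open>i + j \<le> m\<close> of the convolution to a rectangle
  bounds each partial sum in terms of itself. Only finite sums of \<beta> occur, so with
  \<open>K < 1\<close> this yields boundedness before convergence is known.\<close>

lemma sum_inar_beta_le:
  assumes "\<And>k. \<alpha> k \<ge> 0" and "(\<lambda>k. \<alpha> (Suc k)) sums K"
  shows "(\<Sum>k\<le>n. inar_beta \<alpha> k) \<le> 1 + K * (\<Sum>k\<le>n. inar_beta \<alpha> k)"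
proof (cases n)
  case 0
  have "0 \<le> K"
    using assms by (metis sums_iff suminf_nonneg)
  then show ?thesis by (simp add: 0)
next
  case (Suc m)
  let ?\<beta> = "inar_beta \<alpha>"
  have "(\<Sum>k\<le>n. ?\<beta> k) = 1 + (\<Sum>k\<le>m. ?\<beta> (Suc k))"
    unfolding Suc by (subst sum.atMost_Suc_shift) simp
  also have "(\<Sum>k\<le>m. ?\<beta> (Suc k)) = (\<Sum>k\<le>m. \<Sum>i\<le>k. \<alpha> (Suc i) * ?\<beta> (k - i))"
    by (simp add: inar_beta_Suc del: inar_beta.simps)
  also have "\<dots> = (\<Sum>(i, j)\<in>{(i, j). i + j \<le> m}. \<alpha> (Suc i) * ?\<beta> j)"
    by (rule sum.triangle_reindex_eq[symmetric])
  also have "\<dots> \<le> (\<Sum>(i, j)\<in>{..m} \<times> {..n}. \<alpha> (Suc i) * ?\<beta> j)"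
    using assms(1) inar_beta_nonneg[OF assms(1)] Suc by (intro sum_mono2) auto
  also have "\<dots> = (\<Sum>i\<le>m. \<alpha> (Suc i)) * (\<Sum>k\<le>n. ?\<beta> k)"
    by (simp add: sum_product sum.cartesian_product)
  also have "\<dots> \<le> K * (\<Sum>k\<le>n. ?\<beta> k)"
    using assms inar_beta_nonneg[OF assms(1)]
    by (intro mult_right_mono sum_nonneg) (auto simp: sums_iff intro!: sum_le_suminf)
  finally show ?thesis by simp
qed

text \<open>The self-bound makes the partial sums bounded, hence convergent. The value then comes
  from the Cauchy product, under which the recursion reads B - 1 = K B for the total mass B.\<close>

lemma inar_beta_sums:
  assumes "\<And>k. \<alpha> k \<ge> 0" and "(\<lambda>k. \<alpha> (Suc k)) sums K" and "K < 1"
  shows "inar_beta \<alpha> sums (1 / (1 - K))"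
proof -
  let ?\<beta> = "inar_beta \<alpha>"
  have "(\<Sum>k<n. ?\<beta> k) \<le> 1 / (1 - K)" for n
  proof -
    have "(\<Sum>k<n. ?\<beta> k) \<le> (\<Sum>k\<le>n. ?\<beta> k)"
      using inar_beta_nonneg[OF assms(1)] by (intro sum_mono2) auto
    also have "\<dots> \<le> 1 / (1 - K)"
      using sum_inar_beta_le[OF assms(1,2), of n] assms(3) by (simp add: field_simps)
    finally show ?thesis .
  qed
  then have summable: "summable ?\<beta>"
    using inar_beta_nonneg[OF assms(1)] by (intro summableI_nonneg_bounded) auto
  have "(\<lambda>k. \<Sum>i\<le>k. \<alpha> (Suc i) * ?\<beta> (k - i)) sums ((\<Sum>k. \<alpha> (Suc k)) * (\<Sum>k. ?\<beta> k))"
    using assms summable inar_beta_nonneg[OF assms(1)]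
    by (intro Cauchy_product_sums) (auto simp: sums_iff)
  then have "(\<lambda>k. ?\<beta> (Suc k)) sums (K * (\<Sum>k. ?\<beta> k))"
    using assms(2) by (simp add: inar_beta_Suc sums_iff del: inar_beta.simps)
  then have "K * (\<Sum>k. ?\<beta> k) = (\<Sum>k. ?\<beta> k) - 1"
    using suminf_split_head[OF summable] by (simp add: sums_iff del: inar_beta.simps(2))
  then have "(\<Sum>k. ?\<beta> k) = 1 / (1 - K)"
    using assms(3) by (simp add: field_simps)
  with summable show ?thesis by (simp add: sums_iff)
qed

text \<open>The double sum of \<open>\<beta>\<^sub>k \<alpha>\<^sub>j x\<^bsub>k+j\<^esub>\<close> is absolutely convergent; summing it along the
  diagonals \<open>k + j = m\<close> gives \<open>\<beta>\<^sub>m x\<^sub>m\<close> by the recursion for \<open>\<beta>\<close>.\<close>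

lemma inar_beta_moving_average_sums:
  fixes x :: "nat \<Rightarrow> real"
  assumes \<alpha>: "\<And>k. \<alpha> k \<ge> 0" and x: "\<And>k. x k \<ge> 0"
    and summable_\<beta>x: "summable (\<lambda>k. inar_beta \<alpha> k * x k)"
    and summable_\<alpha>x: "\<And>k. summable (\<lambda>j. \<alpha> (Suc j) * x (k + Suc j))"
  shows "(\<lambda>k. inar_beta \<alpha> k * (x k - (\<Sum>j. \<alpha> (Suc j) * x (k + Suc j)))) sums x 0"
proof -
  let ?\<beta> = "inar_beta \<alpha>"
  define S where "S = (\<Sum>k. ?\<beta> k * x k)"
  have nonneg: "?\<beta> k \<ge> 0" for k
    by (rule inar_beta_nonneg[OF \<alpha>])
  define f where "f = (\<lambda>(k, j). ?\<beta> k * \<alpha> (Suc j) * x (k + Suc j))"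
  have f_nonneg: "f p \<ge> 0" for p
    using \<alpha> x nonneg by (auto simp: f_def split: prod.split)
  \<comment> \<open>The summand with inner index \<open>i\<close> carries lag \<open>Suc i\<close>,
    so the diagonal numbered \<open>m\<close> collects the terms with
    \<open>x (Suc m)\<close>.\<close>
  have diagonal: "(\<Sum>i\<le>m. f (m - i, i)) = ?\<beta> (Suc m) * x (Suc m)" for m
    by (auto simp: f_def inar_beta_Suc sum_distrib_left mult_ac simp del: inar_beta.simps intro!: sum.cong)
  \<comment> \<open>Lags start at 1, so no diagonal reaches \<open>x 0\<close>. The double sum falls
    short of \<open>S\<close> by exactly this term, and the shortfall is what remains in the final
    difference.\<close>
  have "(\<lambda>m. ?\<beta> (Suc m) * x (Suc m)) sums (S - x 0)"
    using summable_\<beta>x unfolding S_def by (subst sums_Suc_iff) (simp add: sums_iff)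
  then have "((\<lambda>m. \<Sum>i\<le>m. f (m - i, i)) has_sum (S - x 0)) UNIV"
    unfolding diagonal by (rule sums_nonneg_imp_has_sum) (simp add: x nonneg del: inar_beta.simps)
  then have "((\<lambda>(m, i). f (m - i, i)) has_sum (S - x 0)) (SIGMA m:UNIV. {..m})"
    using f_nonneg
    by (intro has_sum_SigmaI[where g = "\<lambda>m. \<Sum>i\<le>m. f (m - i, i)"] summable_on_SigmaI[where g = "\<lambda>m. \<Sum>i\<le>m. f (m - i, i)"])
      (auto simp: summable_on_def)
  also have "?this \<longleftrightarrow> (f has_sum (S - x 0)) UNIV"
    by (intro has_sum_reindex_bij_witness[where i = "\<lambda>(k, j). (k + j, j)" and j = "\<lambda>(m, i). (m - i, i)"]) auto
  finally have f_sum: "(f has_sum (S - x 0)) (SIGMA k:UNIV. UNIV)"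
    by simp
  have "((\<lambda>j. f (k, j)) has_sum (?\<beta> k * (\<Sum>j. \<alpha> (Suc j) * x (k + Suc j)))) UNIV" for k
  proof -
    have "(\<lambda>j. f (k, j)) sums (?\<beta> k * (\<Sum>j. \<alpha> (Suc j) * x (k + Suc j)))"
      using sums_mult[OF summable_sums[OF summable_\<alpha>x[of k]], of "?\<beta> k"] by (simp add: f_def mult_ac)
    then show ?thesis
      using f_nonneg by (rule sums_nonneg_imp_has_sum)
  qed
  then have "((\<lambda>k. ?\<beta> k * (\<Sum>j. \<alpha> (Suc j) * x (k + Suc j))) has_sum (S - x 0)) UNIV"
    by (intro has_sum_SigmaD[OF f_sum]) auto
  then have "(\<lambda>k. ?\<beta> k * (\<Sum>j. \<alpha> (Suc j) * x (k + Suc j))) sums (S - x 0)"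
    by (rule has_sum_imp_sums)
  from sums_diff[OF summable_sums[OF summable_\<beta>x] this] show ?thesis
    by (simp add: S_def algebra_simps)
qed

section \<open>Poisson means and series of extended naturals\<close>

lemma nn_integral_pois:
  assumes "r \<ge> 0"
  shows "(\<integral>\<^sup>+x. of_nat x \<partial>measure_pmf (pois r)) = ennreal r"
proof (cases "r = 0")
  case True
  then show ?thesis by (simp add: pois_def)
next
  case False
  with assms have r: "r > 0" by simp
  have "(\<lambda>k. r * exp (-r) * (r ^ k / fact k)) sums (r * exp (-r) * exp r)"
    using exp_converges[of r] by (intro sums_mult) (simp add: divide_inverse mult.commute)
  \<comment> \<open>Size biasing: k + 1 times the Poisson weight at k + 1 is \<open>r\<close> times
    the weight at k.\<close>
  also have "(\<lambda>k. r * exp (-r) * (r ^ k / fact k)) = (\<lambda>k. pmf (poisson_pmf r) (Suc k) * real (Suc k))"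
    using r by (auto simp: fun_eq_iff divide_simps simp del: of_nat_Suc)
  also have "r * exp (-r) * exp r = r"
    by (simp add: exp_minus)
  finally have sums: "(\<lambda>k. pmf (poisson_pmf r) k * real k) sums r"
    by (subst (asm) sums_Suc_iff) simp
  have "(\<integral>\<^sup>+x. of_nat x \<partial>measure_pmf (pois r)) = (\<integral>\<^sup>+x. ennreal (pmf (poisson_pmf r) x * real x) \<partial>count_space UNIV)"
    using r by (simp add: pois_def nn_integral_measure_pmf ennreal_mult ennreal_of_nat_eq_real_of_nat del: pmf_poisson)
  also have "\<dots> = (\<Sum>k. ennreal (pmf (poisson_pmf r) k * real k))"
    by (rule nn_integral_count_space_nat)
  also have "\<dots> = ennreal r"
    using sums by (intro suminf_ennreal_eq) auto
  finally show ?thesis .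
qed

text \<open>If the sum is finite, the partial sums are bounded naturals; they take finitely many
  values, so their supremum is a maximum. This keeps the Picard iterates integer valued or
  infinite.\<close>

lemma suminf_of_nat_ennreal:
  fixes f :: "nat \<Rightarrow> ennreal"
  assumes "\<And>i. f i \<in> insert \<infinity> (range of_nat)"
  shows "(\<Sum>i. f i) \<in> insert \<infinity> (range of_nat)"
proof (cases "(\<Sum>i. f i) = \<infinity>")
  case False
  have "f i \<noteq> \<infinity>" for i
    using False sum_le_suminf[of f "{i}"] by (auto simp: top_unique)
  with assms have "\<exists>g. \<forall>i. f i = of_nat (g i)"
    by (intro choice) blast
  then obtain g where g: "f = (\<lambda>i. of_nat (g i))"
    by auto
  define s where "s n = (\<Sum>i<n. g i)" for n
  have partial: "(\<Sum>i<n. f i) = of_nat (s n)" for n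
    by (simp add: g s_def)
  have le: "of_nat (s n) \<le> (\<Sum>i. f i)" for n
    unfolding partial[symmetric] by (intro sum_le_suminf) auto
  have "(\<Sum>i. f i) < top"
    using False by (simp add: less_top)
  then obtain b where "(\<Sum>i. f i) \<le> of_nat b"
    using ennreal_Ex_less_of_nat less_imp_le by blast
  then have "range s \<subseteq> {..b}"
    using le order_trans by (fastforce simp: of_nat_le_iff)
  then have fin: "finite (range s)"
    by (rule finite_subset) simp
  have "(\<Sum>i. f i) = (SUP n. of_nat (s n))"
    by (simp add: suminf_eq_SUP partial)
  also have "\<dots> = of_nat (Max (range s))"
  proof (rule antisym)
    show "(SUP n. of_nat (s n)) \<le> (of_nat (Max (range s)) :: ennreal)"
      using fin by (intro SUP_least) (auto intro: Max_ge)
    have "Max (range s) \<in> range s"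
      using fin by (intro Max_in) auto
    then obtain n where "Max (range s) = s n" by auto
    then show "(of_nat (Max (range s)) :: ennreal) \<le> (SUP n. of_nat (s n))"
      by (auto intro: SUP_upper)
  qed
  finally show ?thesis by auto
qed auto

text \<open>Layer-cake formula: exactly \<open>y\<close> naturals lie below an integer
  \<open>y\<close>, and all of them lie below infinity. It turns expected indicators back into a
  mean population size in Wald's identity.\<close>

lemma suminf_indicator_lessThan_ennreal:
  fixes y :: ennreal
  assumes "y \<in> insert \<infinity> (range of_nat)"
  shows "(\<Sum>l. if of_nat l < y then 1 else 0) = y"
proof (cases "y = \<infinity>")
  case True
  then show ?thesis
    by (simp add: suminf_eq_SUP of_nat_less_top ennreal_SUP_of_nat_eq_top)
next
  case False
  with assms obtain m where "y = of_nat m" by auto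
  then show ?thesis
    by (subst suminf_finite[of "{..<m}"]) auto
qed

section \<open>Picard iteration along a fixed noise configuration\<close>

text \<open>The sum with a random upper bound is encoded as a full series with an indicator. It
  makes sense for infinite \<open>y\<close>, and Tonelli and independence apply term by term. The
  shift to \<open>Suc l\<close> lets a finite integer value use exactly the copies from 1 up to that
  value.\<close>

definition inar_step :: "(noise_index \<Rightarrow> nat) \<Rightarrow> (int \<Rightarrow> ennreal) \<Rightarrow> int \<Rightarrow> ennreal" where
  "inar_step w y n = of_nat (w (Immigration n)) +
     (\<Sum>k. \<Sum>l. if of_nat l < y (n - int (Suc k)) then of_nat (w (Offspring n (Suc k) (Suc l))) else 0)"

primrec inar_approx :: "nat \<Rightarrow> (noise_index \<Rightarrow> nat) \<Rightarrow> int \<Rightarrow> ennreal" where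
  "inar_approx 0 w = (\<lambda>_. 0)"
| "inar_approx (Suc m) w = inar_step w (inar_approx m w)"

definition inar_limit :: "(noise_index \<Rightarrow> nat) \<Rightarrow> int \<Rightarrow> ennreal" where
  "inar_limit w n = (SUP m. inar_approx m w n)"

fun noise_time :: "noise_index \<Rightarrow> int" where
  "noise_time (Immigration n) = n"
| "noise_time (Offspring n k l) = n"

fun shift_index :: "int \<Rightarrow> noise_index \<Rightarrow> noise_index" where
  "shift_index h (Immigration n) = Immigration (n + h)"
| "shift_index h (Offspring n k l) = Offspring (n + h) k l"

text \<open>This index set is disjoint from \<open>noise_before n\<close>; that disjointness is the
  source of the independence between present noise and past population.\<close>

definition noise_at :: "int \<Rightarrow> noise_index set" where
  "noise_at n = {i \<in> noise_indices. noise_time i = n}"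

definition noise_before :: "int \<Rightarrow> noise_index set" where
  "noise_before n = {i \<in> noise_indices. noise_time i < n}"

lemma Immigration_in_noise_indices [simp]: "Immigration n \<in> noise_indices"
  by (simp add: noise_indices_def)

lemma Offspring_in_noise_indices [simp]: "Offspring n k l \<in> noise_indices \<longleftrightarrow> 1 \<le> k \<and> 1 \<le> l"
  by (auto simp: noise_indices_def)

lemma shift_index_in_noise_indices [simp]: "shift_index h i \<in> noise_indices \<longleftrightarrow> i \<in> noise_indices"
  by (cases i) auto

lemma inj_shift_index: "inj (shift_index h)"
proof (rule injI)
  fix i j assume "shift_index h i = shift_index h j"
  then show "i = j" by (cases i; cases j) auto
qed

lemma shift_index_image_noise_indices: "shift_index h ` noise_indices = noise_indices"
proof -
  have "i = shift_index h (shift_index (- h) i)" for i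
    by (cases i) auto
  then show ?thesis
    by (metis image_subset_iff shift_index_in_noise_indices subsetI subset_antisym image_eqI)
qed

section \<open>Monotonicity of the iteration and the fixed point\<close>

lemma inar_step_mono:
  assumes "y \<le> y'"
  shows "inar_step w y \<le> inar_step w y'"
  using assms unfolding inar_step_def le_fun_def
  by (intro allI add_left_mono suminf_le) (auto intro: less_le_trans)

lemma incseq_inar_approx: "incseq (\<lambda>m. inar_approx m w n)"
proof -
  have "inar_approx m w \<le> inar_approx (Suc m) w" for m
  proof (induction m)
    case 0
    show ?case by (simp add: le_fun_def)
  next
    case (Suc m)
    then show ?case
      unfolding inar_approx.simps by (rule inar_step_mono)
  qed
  then show ?thesis
    by (intro incseq_SucI) (rule le_funD)
qed

lemma SUP_Suc_eq:
  fixes f :: "nat \<Rightarrow> 'a :: complete_lattice"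
  assumes "incseq f"
  shows "(SUP m. f (Suc m)) = (SUP m. f m)"
  using assms by (intro antisym SUP_mono) (auto intro: incseq_SucD)

text \<open>Comparing with \<open>l < y\<close> instead of \<open>l + 1 \<le> y\<close> makes the recursion continuous along
  increasing sequences, so that no integrality is needed here.\<close>

lemma inar_step_limit: "inar_step w (inar_limit w) n = inar_limit w n"
proof -
  let ?c = "\<lambda>m k l. if of_nat l < inar_approx m w (n - int (Suc k))
    then of_nat (w (Offspring n (Suc k) (Suc l))) else 0 :: ennreal"
  have inc: "incseq (\<lambda>m. ?c m k l)" for k l
  proof (rule incseq_SucI)
    fix m
    have "inar_approx m w (n - int (Suc k)) \<le> inar_approx (Suc m) w (n - int (Suc k))"
      by (rule incseq_SucD[OF incseq_inar_approx])
    then show "?c m k l \<le> ?c (Suc m) k l"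
      by (auto simp del: inar_approx.simps dest: less_le_trans)
  qed
  have SUP_c: "(if of_nat l < inar_limit w (n - int (Suc k))
    then of_nat (w (Offspring n (Suc k) (Suc l))) else 0) = (SUP m. ?c m k l)" for k l
  proof (cases "of_nat l < inar_limit w (n - int (Suc k))")
    case True
    then obtain m where "of_nat l < inar_approx m w (n - int (Suc k))"
      by (auto simp: inar_limit_def less_SUP_iff)
    then show ?thesis
      using True by (intro antisym SUP_least SUP_upper2[of m]) auto
  next
    case False
    then have "\<not> of_nat l < inar_approx m w (n - int (Suc k))" for m
      by (auto simp: inar_limit_def less_SUP_iff)
    with False show ?thesis by simp
  qed
  have "inar_step w (inar_limit w) n = of_nat (w (Immigration n)) + (\<Sum>k. \<Sum>l. SUP m. ?c m k l)"
    unfolding inar_step_def SUP_c ..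
  \<comment> \<open>Monotone convergence for series is used twice, first inside over the copies and
    then outside over the lags.\<close>
  also have "(\<Sum>k. \<Sum>l. SUP m. ?c m k l) = (\<Sum>k. SUP m. \<Sum>l. ?c m k l)"
    using inc by (intro arg_cong[where f = suminf] ext ennreal_suminf_SUP_eq)
  also have "\<dots> = (SUP m. \<Sum>k. \<Sum>l. ?c m k l)"
    using inc by (intro ennreal_suminf_SUP_eq) (simp add: incseq_def suminf_le)
  also have "of_nat (w (Immigration n)) + \<dots> = (SUP m. inar_approx (Suc m) w n)"
    by (simp add: inar_step_def ennreal_SUP_add_right)
  also have "\<dots> = inar_limit w n"
    unfolding inar_limit_def by (rule SUP_Suc_eq[OF incseq_inar_approx])
  finally show ?thesis .
qed

lemma inar_step_of_nat: "inar_step w y n \<in> insert \<infinity> (range of_nat)"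
proof -
  have "(\<Sum>k. \<Sum>l. if of_nat l < y (n - int (Suc k)) then of_nat (w (Offspring n (Suc k) (Suc l))) else 0)
    \<in> insert \<infinity> (range of_nat :: ennreal set)"
    by (intro suminf_of_nat_ennreal) (auto simp del: of_nat_Suc intro: range_eqI[of _ _ 0])
  then show ?thesis
    unfolding inar_step_def by (auto simp del: of_nat_add simp: of_nat_add[symmetric])
qed

lemma inar_approx_of_nat: "inar_approx m w n \<in> insert \<infinity> (range of_nat)"
proof (cases m)
  case (Suc m')
  then show ?thesis
    using inar_step_of_nat by simp
qed (auto intro: range_eqI[of _ _ 0])

lemma inar_limit_of_nat: "inar_limit w n \<in> insert \<infinity> (range of_nat)"
  by (subst inar_step_limit[symmetric]) (rule inar_step_of_nat)

text \<open>Causality: positive lags refer only to earlier times, so by induction the value at time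
  \<open>n\<close> reads no later noise. Agreement is asked only on \<open>noise_indices\<close>, so
  that the noise may be replaced by its restriction, which is \<open>undefined\<close>
  elsewhere.\<close>

lemma inar_approx_cong:
  assumes "\<And>i. i \<in> noise_indices \<Longrightarrow> noise_time i \<le> n \<Longrightarrow> w i = w' i"
  shows "inar_approx m w n = inar_approx m w' n"
  using assms
proof (induction m arbitrary: n)
  case (Suc m)
  have "inar_approx m w (n - int (Suc k)) = inar_approx m w' (n - int (Suc k))" for k
    by (rule Suc.IH) (auto intro: Suc.prems)
  then show ?case
    using Suc.prems by (simp add: inar_step_def cong: if_cong)
qed simp

lemma inar_limit_cong:
  assumes "\<And>i. i \<in> noise_indices \<Longrightarrow> noise_time i \<le> n \<Longrightarrow> w i = w' i"
  shows "inar_limit w n = inar_limit w' n"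
  unfolding inar_limit_def using inar_approx_cong[OF assms] by simp

text \<open>The step treats all times alike. This makes the limit a shift-equivariant functional of
  the noise, from which stationarity is obtained.\<close>

lemma inar_approx_shift: "inar_approx m (\<lambda>i. w (shift_index h i)) n = inar_approx m w (n + h)"
proof (induction m arbitrary: n)
  case (Suc m)
  have "n - int (Suc k) + h = n + h - int (Suc k)" for k by simp
  then show ?case
    by (simp only: inar_approx.simps inar_step_def Suc shift_index.simps)
qed simp

lemma inar_limit_shift: "inar_limit (\<lambda>i. w (shift_index h i)) n = inar_limit w (n + h)"
  by (simp add: inar_limit_def inar_approx_shift)

text \<open>Elements of the product space are \<open>undefined\<close> off \<open>I\<close>, so a
  coordinate there is constant. Functionals of the noise are thus measurable for every index set at
  once, be it the full one or the past.\<close>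

lemma measurable_noise_component:
  "(\<lambda>w. w i) \<in> PiM I (\<lambda>_. count_space UNIV) \<rightarrow>\<^sub>M (count_space UNIV :: nat measure)"
proof (cases "i \<in> I")
  case False
  then show ?thesis
    by (subst measurable_cong[where g = "\<lambda>_. undefined"]) (auto simp: space_PiM PiE_def extensional_def)
qed simp

lemma measurable_inar_approx:
  "(\<lambda>w. inar_approx m w n) \<in> borel_measurable (PiM I (\<lambda>_. count_space UNIV))"
proof (induction m arbitrary: n)
  case (Suc m)
  note [measurable] = Suc measurable_noise_component
  show ?case
    unfolding inar_approx.simps inar_step_def by measurable
qed simp

lemma measurable_inar_limit:
  "(\<lambda>w. inar_limit w n) \<in> borel_measurable (PiM I (\<lambda>_. count_space UNIV))"
  unfolding inar_limit_def by (intro borel_measurable_SUP measurable_inar_approx) auto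

text \<open>Where the limit is infinite, \<open>enn2real\<close> gives 0; under the INAR noise this
  has probability 0. Elsewhere the limit is a natural number and the floor is exact.\<close>

definition inar_solution :: "(noise_index \<Rightarrow> nat) \<Rightarrow> int \<Rightarrow> nat" where
  "inar_solution w n = nat \<lfloor>enn2real (inar_limit w n)\<rfloor>"

lemma inar_solution_eq:
  assumes "inar_limit w n \<noteq> \<infinity>"
  shows "of_nat (inar_solution w n) = inar_limit w n"
proof -
  obtain m where "inar_limit w n = of_nat m"
    using assms inar_limit_of_nat[of w n] by auto
  then show ?thesis by (simp add: inar_solution_def)
qed

lemma inar_solution_cong:
  assumes "\<And>i. i \<in> noise_indices \<Longrightarrow> noise_time i \<le> n \<Longrightarrow> w i = w' i"
  shows "inar_solution w n = inar_solution w' n"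
  unfolding inar_solution_def using inar_limit_cong[OF assms] by simp

lemma inar_solution_shift: "inar_solution (\<lambda>i. w (shift_index h i)) n = inar_solution w (n + h)"
  by (simp add: inar_solution_def inar_limit_shift)

lemma measurable_inar_solution:
  "(\<lambda>w. inar_solution w n) \<in> PiM I (\<lambda>_. count_space UNIV) \<rightarrow>\<^sub>M count_space UNIV"
proof -
  note [measurable] = measurable_inar_limit
  show ?thesis unfolding inar_solution_def by measurable
qed

lemma inar_solution_recursion:
  assumes finite: "\<And>n. inar_limit w n \<noteq> \<infinity>"
  shows "((\<lambda>k. real (\<Sum>l = 1..inar_solution w (n - int k). w (Offspring n k l))) has_sum
    (real (inar_solution w n) - real (w (Immigration n)))) {1..}"
proof -
  let ?Z = "inar_solution w"
  define g where "g k = (\<Sum>l = 1..?Z (n - int k). w (Offspring n k l))" for k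
  have "(\<Sum>l. if of_nat l < inar_limit w (n - int k) then of_nat (w (Offspring n k (Suc l))) else 0 :: ennreal)
    = of_nat (g k)" for k
  proof -
    have "(\<Sum>l. if of_nat l < inar_limit w (n - int k) then of_nat (w (Offspring n k (Suc l))) else 0 :: ennreal)
      = (\<Sum>l<?Z (n - int k). of_nat (w (Offspring n k (Suc l))))"
      unfolding inar_solution_eq[OF finite, symmetric] by (subst suminf_finite[of "{..<?Z (n - int k)}"]) auto
    also have "\<dots> = of_nat (\<Sum>l<?Z (n - int k). w (Offspring n k (Suc l)))"
      by simp
    also have "(\<Sum>l<?Z (n - int k). w (Offspring n k (Suc l))) = g k"
      unfolding g_def by (rule sum.reindex_bij_witness[of _ "\<lambda>l. l - 1" Suc]) auto
    finally show ?thesis .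
  qed
  then have eq: "of_nat (w (Immigration n)) + (\<Sum>k. of_nat (g (Suc k))) = (of_nat (?Z n) :: ennreal)"
    unfolding inar_solution_eq[OF finite] by (subst inar_step_limit[symmetric]) (simp only: inar_step_def)
  \<comment> \<open>Infinity has to be excluded before the extended identity can be read as a
    convergent real series; the offspring total is part of the finite value
    \<open>?Z n\<close>.\<close>
  have sum_ne: "(\<Sum>k. of_nat (g (Suc k)) :: ennreal) \<noteq> \<infinity>"
  proof
    assume "(\<Sum>k. of_nat (g (Suc k)) :: ennreal) = \<infinity>"
    with eq show False by simp
  qed
  then have summable: "summable (\<lambda>k. real (g (Suc k)))"
    by (intro summable_suminf_not_top) (simp_all add: ennreal_of_nat_eq_real_of_nat)
  then have "ennreal (real (w (Immigration n)) + (\<Sum>k. real (g (Suc k)))) = ennreal (real (?Z n))"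
    using eq by (simp add: ennreal_of_nat_eq_real_of_nat ennreal_plus suminf_nonneg suminf_ennreal2)
  then have "(\<Sum>k. real (g (Suc k))) = real (?Z n) - real (w (Immigration n))"
    by (simp add: suminf_nonneg summable del: ennreal_plus)
  then have "((\<lambda>k. real (g (Suc k))) has_sum (real (?Z n) - real (w (Immigration n)))) UNIV"
    using summable by (intro sums_nonneg_imp_has_sum) (auto simp: sums_iff)
  also have "?this \<longleftrightarrow> ((\<lambda>k. real (g k)) has_sum (real (?Z n) - real (w (Immigration n)))) {1..}"
    by (rule has_sum_reindex_bij_witness[of _ "\<lambda>k. k - 1" Suc]) auto
  finally show ?thesis
    unfolding g_def .
qed

section \<open>The law of the Picard limit\<close>

context prob_space
begin

section \<open>General facts on independence\<close>

lemma indep_var_nn_integral_mult: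
  fixes A B :: "'a \<Rightarrow> ennreal"
  assumes "indep_var borel A borel B"
  shows "(\<integral>\<^sup>+\<omega>. A \<omega> * B \<omega> \<partial>M) = (\<integral>\<^sup>+\<omega>. A \<omega> \<partial>M) * (\<integral>\<^sup>+\<omega>. B \<omega> \<partial>M)"
proof -
  have "case_bool borel borel = (\<lambda>_. borel :: ennreal measure)"
    by (auto split: bool.split)
  with assms have "indep_vars (\<lambda>_. borel) (case_bool A B) UNIV"
    by (simp add: indep_var_def)
  from indep_vars_nn_integral[OF _ this] show ?thesis
    by (simp add: UNIV_bool mult.commute)
qed

text \<open>Composition only shrinks the generated sigma-algebra, and independence is inherited by
  smaller ones. The result has the form that \<open>stationary_inar_solution\<close>
  demands.\<close>

lemma indep_var_compose_vimage_algebra: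
  assumes indep: "indep_var S A T B" and f: "f \<in> S \<rightarrow>\<^sub>M S'" and g: "g \<in> T \<rightarrow>\<^sub>M T'"
  shows "indep_set (sets (vimage_algebra (space M) (f \<circ> A) S')) (sets (vimage_algebra (space M) (g \<circ> B) T'))"
proof -
  have "indep_set (sets (vimage_algebra (space M) A S)) (sets (vimage_algebra (space M) B T))"
    using indep unfolding indep_var_eq sets_vimage_algebra by simp
  moreover have "sets (vimage_algebra (space M) (f \<circ> A) S') \<subseteq> sets (vimage_algebra (space M) A S)"
    using indep f
    by (intro sets_image_in_sets measurable_comp[OF measurable_vimage_algebra1])
      (auto simp: indep_var_eq measurable_space)
  moreover have "sets (vimage_algebra (space M) (g \<circ> B) T') \<subseteq> sets (vimage_algebra (space M) B T)"
    using indep g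
    by (intro sets_image_in_sets measurable_comp[OF measurable_vimage_algebra1])
      (auto simp: indep_var_eq measurable_space)
  ultimately show ?thesis
    unfolding indep_set_def by (elim indep_sets_mono_sets) (auto split: bool.split)
qed

lemma indep_vars_reindex:
  assumes indep: "indep_vars M' X (f ` I)" and inj: "inj_on f I"
  shows "indep_vars (\<lambda>i. M' (f i)) (\<lambda>i. X (f i)) I"
proof -
  \<comment> \<open>Each index forms a block of its own; injectivity makes the blocks
    \<open>{f i}\<close> disjoint, and evaluation at \<open>f i\<close> recovers the
    variable.\<close>
  have "indep_vars (\<lambda>i. PiM {f i} M') (\<lambda>i \<omega>. restrict (\<lambda>j. X j \<omega>) {f i}) I"
    using inj by (intro indep_vars_restrict[OF indep]) (auto simp: disjoint_family_on_def inj_on_def)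
  from indep_vars_compose2[OF this, of "\<lambda>i w. w (f i)" "\<lambda>i. M' (f i)"] show ?thesis
    by simp
qed

end

locale inar_noise_space = prob_space +
  fixes \<alpha> :: "nat \<Rightarrow> real" and \<epsilon> :: "int \<Rightarrow> 'a \<Rightarrow> nat"
    and \<xi> :: "int \<Rightarrow> nat \<Rightarrow> nat \<Rightarrow> 'a \<Rightarrow> nat" and K :: real
  assumes noise: "inar_noise \<alpha> \<epsilon> \<xi>"
    and \<alpha>_nonneg: "\<And>k. \<alpha> k \<ge> 0"
    and \<alpha>_sums: "(\<lambda>k. \<alpha> (Suc k)) sums K"
    and K_less: "K < 1"
begin

abbreviation W :: "'a \<Rightarrow> noise_index \<Rightarrow> nat" where
  "W \<omega> \<equiv> \<lambda>i. noise \<epsilon> \<xi> i \<omega>"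

lemma indep_noise: "indep_vars (\<lambda>_. count_space UNIV) (noise \<epsilon> \<xi>) noise_indices"
  using noise by (simp add: inar_noise_def)

lemma measurable_noise:
  "i \<in> noise_indices \<Longrightarrow> noise \<epsilon> \<xi> i \<in> M \<rightarrow>\<^sub>M count_space UNIV"
  using indep_noise by (auto simp: indep_vars_def)

lemma measurable_restrict_noise:
  "B \<subseteq> noise_indices \<Longrightarrow> (\<lambda>\<omega>. restrict (W \<omega>) B) \<in> M \<rightarrow>\<^sub>M PiM B (\<lambda>_. count_space UNIV)"
  by (intro measurable_restrict measurable_noise) auto

text \<open>Measurability of the noise is known on \<open>noise_indices\<close>; causality allows
  the noise to be restricted to them first.\<close>

lemma measurable_approx_noise: "(\<lambda>\<omega>. inar_approx m (W \<omega>) n) \<in> borel_measurable M"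
proof -
  have "(\<lambda>\<omega>. inar_approx m (restrict (W \<omega>) noise_indices) n) \<in> borel_measurable M"
    by (rule measurable_compose[OF measurable_restrict_noise measurable_inar_approx]) simp
  also have "(\<lambda>\<omega>. inar_approx m (restrict (W \<omega>) noise_indices) n) = (\<lambda>\<omega>. inar_approx m (W \<omega>) n)"
    by (intro ext inar_approx_cong) simp
  finally show ?thesis .
qed

lemma measurable_solution_noise: "(\<lambda>\<omega>. inar_solution (W \<omega>) n) \<in> M \<rightarrow>\<^sub>M count_space UNIV"
proof -
  have "(\<lambda>\<omega>. inar_solution (restrict (W \<omega>) noise_indices) n) \<in> M \<rightarrow>\<^sub>M count_space UNIV"
    by (rule measurable_compose[OF measurable_restrict_noise measurable_inar_solution]) simp
  also have "(\<lambda>\<omega>. inar_solution (restrict (W \<omega>) noise_indices) n) = (\<lambda>\<omega>. inar_solution (W \<omega>) n)"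
    by (intro ext inar_solution_cong) simp
  finally show ?thesis .
qed

section \<open>Means of the Picard iterates and of their limit\<close>

lemma nn_integral_immigration: "(\<integral>\<^sup>+\<omega>. of_nat (\<epsilon> n \<omega>) \<partial>M) = ennreal (\<alpha> 0)"
proof -
  have "(\<integral>\<^sup>+\<omega>. of_nat (\<epsilon> n \<omega>) \<partial>M) = (\<integral>\<^sup>+x. of_nat x \<partial>distr M (count_space UNIV) (\<epsilon> n))"
    using measurable_noise[of "Immigration n"] by (subst nn_integral_distr) auto
  also have "\<dots> = ennreal (\<alpha> 0)"
    using noise \<alpha>_nonneg by (simp add: inar_noise_def nn_integral_pois)
  finally show ?thesis .
qed

lemma nn_integral_offspring:
  assumes "1 \<le> k" "1 \<le> l"
  shows "(\<integral>\<^sup>+\<omega>. of_nat (\<xi> n k l \<omega>) \<partial>M) = ennreal (\<alpha> k)"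
proof -
  have "(\<integral>\<^sup>+\<omega>. of_nat (\<xi> n k l \<omega>) \<partial>M) = (\<integral>\<^sup>+x. of_nat x \<partial>distr M (count_space UNIV) (\<xi> n k l))"
    using assms measurable_noise[of "Offspring n k l"] by (subst nn_integral_distr) auto
  also have "\<dots> = ennreal (\<alpha> k)"
    using assms noise \<alpha>_nonneg by (simp add: inar_noise_def nn_integral_pois)
  finally show ?thesis .
qed

lemma indep_var_noise_before_at:
  "indep_var (PiM (noise_at n) (\<lambda>_. count_space UNIV)) (\<lambda>\<omega>. restrict (W \<omega>) (noise_at n))
    (PiM (noise_before n) (\<lambda>_. count_space UNIV)) (\<lambda>\<omega>. restrict (W \<omega>) (noise_before n))"
  by (rule indep_var_restrict[OF indep_noise]) (auto simp: noise_at_def noise_before_def)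

text \<open>One term of Wald's identity. As \<open>1 \<le> k\<close>, the iterate at time
  \<open>n - int k\<close> is a function of the noise before \<open>n\<close>, so its indicator is
  independent of the offspring variable at \<open>n\<close> and the expectation of the product
  factors.\<close>

lemma nn_integral_offspring_term:
  assumes "1 \<le> k" "1 \<le> l"
  shows "(\<integral>\<^sup>+\<omega>. (if of_nat j < inar_approx m (W \<omega>) (n - int k) then of_nat (\<xi> n k l \<omega>) else 0) \<partial>M) =
    ennreal (\<alpha> k) * (\<integral>\<^sup>+\<omega>. (if of_nat j < inar_approx m (W \<omega>) (n - int k) then 1 else 0) \<partial>M)"
proof -
  let ?A = "\<lambda>w. of_nat (w (Offspring n k l)) :: ennreal"
  let ?B = "\<lambda>w. if of_nat j < inar_approx m w (n - int k) then 1 else 0 :: ennreal"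
  note [measurable] = measurable_noise_component measurable_inar_approx
  have "indep_var borel (?A \<circ> (\<lambda>\<omega>. restrict (W \<omega>) (noise_at n)))
    borel (?B \<circ> (\<lambda>\<omega>. restrict (W \<omega>) (noise_before n)))"
    by (rule indep_var_compose[OF indep_var_noise_before_at]) measurable
  also have "?A \<circ> (\<lambda>\<omega>. restrict (W \<omega>) (noise_at n)) = (\<lambda>\<omega>. of_nat (\<xi> n k l \<omega>))"
    using assms by (auto simp: noise_at_def)
  also have "?B \<circ> (\<lambda>\<omega>. restrict (W \<omega>) (noise_before n)) = (\<lambda>\<omega>. ?B (W \<omega>))"
  proof
    fix \<omega>
    have "inar_approx m (restrict (W \<omega>) (noise_before n)) (n - int k) = inar_approx m (W \<omega>) (n - int k)"
      using assms by (intro inar_approx_cong) (auto simp: noise_before_def)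
    then show "(?B \<circ> (\<lambda>\<omega>. restrict (W \<omega>) (noise_before n))) \<omega> = ?B (W \<omega>)" by simp
  qed
  finally have "(\<integral>\<^sup>+\<omega>. of_nat (\<xi> n k l \<omega>) * ?B (W \<omega>) \<partial>M) =
      (\<integral>\<^sup>+\<omega>. of_nat (\<xi> n k l \<omega>) \<partial>M) * (\<integral>\<^sup>+\<omega>. ?B (W \<omega>) \<partial>M)"
    by (rule indep_var_nn_integral_mult)
  moreover have "of_nat (\<xi> n k l \<omega>) * ?B (W \<omega>) =
      (if of_nat j < inar_approx m (W \<omega>) (n - int k) then of_nat (\<xi> n k l \<omega>) else 0)" for \<omega>
    by simp
  ultimately show ?thesis
    using assms by (simp add: nn_integral_offspring)
qed

lemma nn_integral_approx_Suc:
  "(\<integral>\<^sup>+\<omega>. inar_approx (Suc m) (W \<omega>) n \<partial>M) = ennreal (\<alpha> 0) +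
    (\<Sum>k. ennreal (\<alpha> (Suc k)) * (\<integral>\<^sup>+\<omega>. inar_approx m (W \<omega>) (n - int (Suc k)) \<partial>M))"
proof -
  have [measurable]: "\<xi> n (Suc k) (Suc l) \<in> M \<rightarrow>\<^sub>M count_space UNIV" for k l
    using measurable_noise[of "Offspring n (Suc k) (Suc l)"] by simp
  have [measurable]: "\<epsilon> n \<in> M \<rightarrow>\<^sub>M count_space UNIV"
    using measurable_noise[of "Immigration n"] by simp
  note [measurable] = measurable_approx_noise
  have "(\<integral>\<^sup>+\<omega>. inar_approx (Suc m) (W \<omega>) n \<partial>M) = ennreal (\<alpha> 0) +
    (\<Sum>k. \<Sum>l. \<integral>\<^sup>+\<omega>. (if of_nat l < inar_approx m (W \<omega>) (n - int (Suc k))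
      then of_nat (\<xi> n (Suc k) (Suc l) \<omega>) else 0) \<partial>M)"
    unfolding inar_approx.simps inar_step_def noise.simps
    by (simp add: nn_integral_add nn_integral_suminf nn_integral_immigration del: of_nat_Suc)
  also have "(\<Sum>k. \<Sum>l. \<integral>\<^sup>+\<omega>. (if of_nat l < inar_approx m (W \<omega>) (n - int (Suc k))
      then of_nat (\<xi> n (Suc k) (Suc l) \<omega>) else 0) \<partial>M) =
    (\<Sum>k. ennreal (\<alpha> (Suc k)) * (\<Sum>l. \<integral>\<^sup>+\<omega>. (if of_nat l < inar_approx m (W \<omega>) (n - int (Suc k)) then 1 else 0) \<partial>M))"
    by (simp add: nn_integral_offspring_term del: of_nat_Suc)
  \<comment> \<open>The iterates are extended naturals, so the layer-cake formula reassembles the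
    indicators over \<open>l\<close> into the iterate itself.\<close>
  also have "(\<lambda>k. \<Sum>l. \<integral>\<^sup>+\<omega>. (if of_nat l < inar_approx m (W \<omega>) (n - int (Suc k)) then 1 else 0) \<partial>M) =
      (\<lambda>k. \<integral>\<^sup>+\<omega>. inar_approx m (W \<omega>) (n - int (Suc k)) \<partial>M)"
    by (rule ext, subst nn_integral_suminf[symmetric])
      (simp_all only: suminf_indicator_lessThan_ennreal[OF inar_approx_of_nat], measurable)
  finally show ?thesis .
qed

lemma K_nonneg: "0 \<le> K"
  using \<alpha>_sums \<alpha>_nonneg by (metis sums_iff suminf_nonneg)

text \<open>The mean of an iterate is the same at all times, so the convolution with \<alpha>
  collapses to multiplication by \<open>K\<close>; the geometric sum then grows by one term as in
  Horner's scheme.\<close>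

lemma nn_integral_approx:
  "(\<integral>\<^sup>+\<omega>. inar_approx m (W \<omega>) n \<partial>M) = ennreal (\<alpha> 0 * (\<Sum>j<m. K ^ j))"
proof (induction m arbitrary: n)
  case (Suc m)
  have "(\<integral>\<^sup>+\<omega>. inar_approx (Suc m) (W \<omega>) n \<partial>M) =
      ennreal (\<alpha> 0) + (\<Sum>k. ennreal (\<alpha> (Suc k))) * ennreal (\<alpha> 0 * (\<Sum>j<m. K ^ j))"
    unfolding nn_integral_approx_Suc Suc by simp
  also have "(\<Sum>k. ennreal (\<alpha> (Suc k))) = ennreal K"
    using \<alpha>_nonneg \<alpha>_sums by (intro suminf_ennreal_eq) auto
  also have "ennreal (\<alpha> 0) + ennreal K * ennreal (\<alpha> 0 * (\<Sum>j<m. K ^ j)) =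
      ennreal (\<alpha> 0 + K * (\<alpha> 0 * (\<Sum>j<m. K ^ j)))"
    using \<alpha>_nonneg K_nonneg by (simp add: ennreal_mult' sum_nonneg)
  also have "\<alpha> 0 + K * (\<alpha> 0 * (\<Sum>j<m. K ^ j)) = \<alpha> 0 * (\<Sum>j<Suc m. K ^ j)"
    by (simp add: sum.lessThan_Suc_shift sum_distrib_left algebra_simps del: sum.lessThan_Suc)
  finally show ?case .
qed simp

lemma nn_integral_limit: "(\<integral>\<^sup>+\<omega>. inar_limit (W \<omega>) n \<partial>M) = ennreal (\<alpha> 0 / (1 - K))"
proof -
  note [measurable] = measurable_approx_noise
  have inc: "incseq (\<lambda>m \<omega>. inar_approx m (W \<omega>) n)"
    using incseqD[OF incseq_inar_approx] by (auto simp: incseq_def le_fun_def)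
  have SUP: "(\<integral>\<^sup>+\<omega>. inar_limit (W \<omega>) n \<partial>M) = (SUP m. \<integral>\<^sup>+\<omega>. inar_approx m (W \<omega>) n \<partial>M)"
    unfolding inar_limit_def by (intro nn_integral_monotone_convergence_SUP inc) measurable
  have "incseq (\<lambda>m. \<integral>\<^sup>+\<omega>. inar_approx m (W \<omega>) n \<partial>M)"
    using inc by (auto simp: incseq_def le_fun_def intro!: nn_integral_mono)
  then have "(\<lambda>m. \<integral>\<^sup>+\<omega>. inar_approx m (W \<omega>) n \<partial>M) \<longlonglongrightarrow> (\<integral>\<^sup>+\<omega>. inar_limit (W \<omega>) n \<partial>M)"
    unfolding SUP by (rule LIMSEQ_SUP)
  moreover have "(\<lambda>m. \<alpha> 0 * (\<Sum>j<m. K ^ j)) \<longlonglongrightarrow> \<alpha> 0 * (1 / (1 - K))"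
    using geometric_sums[of K] K_nonneg K_less by (intro tendsto_mult_left) (simp add: sums_def)
  ultimately show ?thesis
    unfolding nn_integral_approx by (auto intro: LIMSEQ_unique tendsto_ennrealI)
qed

lemma AE_limit_finite: "AE \<omega> in M. \<forall>n. inar_limit (W \<omega>) n \<noteq> \<infinity>"
proof -
  have [measurable]: "(\<lambda>\<omega>. inar_limit (W \<omega>) n) \<in> borel_measurable M" for n
    unfolding inar_limit_def using measurable_approx_noise by measurable
  have "AE \<omega> in M. inar_limit (W \<omega>) n \<noteq> \<infinity>" for n
    by (rule nn_integral_PInf_AE) (simp_all add: nn_integral_limit)
  then show ?thesis by (simp add: AE_all_countable)
qed

section \<open>Stationarity of the limit and independence of its past\<close>

lemma distr_shift_noise:
  "distr M (PiM noise_indices (\<lambda>_. count_space UNIV)) (\<lambda>\<omega>. restrict (\<lambda>i. W \<omega> (shift_index h i)) noise_indices) =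
   distr M (PiM noise_indices (\<lambda>_. count_space UNIV)) (\<lambda>\<omega>. restrict (W \<omega>) noise_indices)"
proof -
  have ne: "noise_indices \<noteq> {}"
    using Immigration_in_noise_indices by blast
  have "indep_vars (\<lambda>_. count_space UNIV) (\<lambda>i. noise \<epsilon> \<xi> (shift_index h i)) noise_indices"
    by (rule indep_vars_reindex)
      (simp_all add: shift_index_image_noise_indices indep_noise inj_on_subset[OF inj_shift_index])
  then have "distr M (PiM noise_indices (\<lambda>_. count_space UNIV)) (\<lambda>\<omega>. restrict (\<lambda>i. W \<omega> (shift_index h i)) noise_indices) =
      PiM noise_indices (\<lambda>i. distr M (count_space UNIV) (noise \<epsilon> \<xi> (shift_index h i)))"
    by (subst (asm) indep_vars_iff_distr_eq_PiM'[OF ne]) (auto simp: measurable_noise comp_def)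
  \<comment> \<open>Independence has made the joint law a product of marginals. These depend on the
    kind of variable and its lag but not on time, so the shift leaves every factor
    unchanged.\<close>
  also have "\<dots> = PiM noise_indices (\<lambda>i. distr M (count_space UNIV) (noise \<epsilon> \<xi> i))"
  proof (rule PiM_cong)
    fix i assume "i \<in> noise_indices"
    then show "distr M (count_space UNIV) (noise \<epsilon> \<xi> (shift_index h i)) = distr M (count_space UNIV) (noise \<epsilon> \<xi> i)"
      using noise by (cases i) (auto simp: inar_noise_def)
  qed simp
  also have "\<dots> = distr M (PiM noise_indices (\<lambda>_. count_space UNIV)) (\<lambda>\<omega>. restrict (W \<omega>) noise_indices)"
    using indep_noise by (subst (asm) indep_vars_iff_distr_eq_PiM'[OF ne]) (auto simp: measurable_noise)
  finally show ?thesis .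
qed

text \<open>The shifted path is the same measurable functional \<open>inar_solution\<close> of the
  shifted noise, whose law is that of the original noise.\<close>

lemma strictly_stationary_solution: "strictly_stationary (\<lambda>n \<omega>. inar_solution (W \<omega>) n)"
  unfolding strictly_stationary_def
proof (intro conjI allI)
  fix h :: int
  let ?P = "PiM (UNIV :: int set) (\<lambda>_. count_space UNIV :: nat measure)"
  let ?N = "PiM noise_indices (\<lambda>_. count_space UNIV :: nat measure)"
  have meas: "inar_solution \<in> ?N \<rightarrow>\<^sub>M ?P"
    using measurable_PiM_single'[of UNIV "\<lambda>n w. inar_solution w n" ?N "\<lambda>_. count_space UNIV"]
    by (auto simp: measurable_inar_solution)
  have "(\<lambda>\<omega> n. inar_solution (W \<omega>) (n + h)) = inar_solution \<circ> (\<lambda>\<omega>. restrict (\<lambda>i. W \<omega> (shift_index h i)) noise_indices)"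
  proof (intro ext)
    fix \<omega> n
    have "inar_solution (W \<omega>) (n + h) = inar_solution (\<lambda>i. W \<omega> (shift_index h i)) n"
      by (rule inar_solution_shift[symmetric])
    also have "\<dots> = inar_solution (restrict (\<lambda>i. W \<omega> (shift_index h i)) noise_indices) n"
      by (rule inar_solution_cong) simp
    finally show "inar_solution (W \<omega>) (n + h) =
        (inar_solution \<circ> (\<lambda>\<omega>. restrict (\<lambda>i. W \<omega> (shift_index h i)) noise_indices)) \<omega> n"
      by simp
  qed
  then have "distr M ?P (\<lambda>\<omega> n. inar_solution (W \<omega>) (n + h)) =
      distr (distr M ?N (\<lambda>\<omega>. restrict (\<lambda>i. W \<omega> (shift_index h i)) noise_indices)) ?P inar_solution"
    using meas by (simp add: distr_distr measurable_restrict measurable_noise)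
  also have "\<dots> = distr M ?P (inar_solution \<circ> (\<lambda>\<omega>. restrict (W \<omega>) noise_indices))"
    unfolding distr_shift_noise using meas by (simp add: distr_distr measurable_restrict measurable_noise)
  also have "inar_solution \<circ> (\<lambda>\<omega>. restrict (W \<omega>) noise_indices) = (\<lambda>\<omega> n. inar_solution (W \<omega>) n)"
    by (auto intro!: ext inar_solution_cong)
  finally show "distr M ?P (\<lambda>\<omega> n. inar_solution (W \<omega>) (n + h)) = distr M ?P (\<lambda>\<omega> n. inar_solution (W \<omega>) n)" .
qed (rule measurable_solution_noise)

text \<open>By causality the path before \<open>n\<close> is a function of the noise before
  \<open>n\<close>, while the first sigma-algebra is generated by coordinates of the noise at
  \<open>n\<close>.\<close>

lemma indep_set_noise_past:
  "indep_set
    (sets (vimage_algebra (space M)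
      (\<lambda>\<omega>. (\<epsilon> n \<omega>, restrict (\<lambda>(k, l). \<xi> n k l \<omega>) ({1..} \<times> {1..})))
      (count_space UNIV \<Otimes>\<^sub>M PiM ({1..} \<times> {1..}) (\<lambda>_. count_space UNIV))))
    (sets (vimage_algebra (space M)
      (\<lambda>\<omega>. restrict (\<lambda>m. inar_solution (W \<omega>) m) {..<n})
      (PiM {..<n} (\<lambda>_. count_space UNIV))))"
proof -
  let ?A = "\<lambda>w :: noise_index \<Rightarrow> nat. (w (Immigration n), restrict (\<lambda>(k, l). w (Offspring n k l)) ({1..} \<times> {1..}))"
  let ?B = "\<lambda>w :: noise_index \<Rightarrow> nat. restrict (\<lambda>m. inar_solution w m) {..<n}"
  let ?S = "count_space UNIV \<Otimes>\<^sub>M PiM ({1..} \<times> {1..}) (\<lambda>_. count_space UNIV) :: (nat \<times> (nat \<times> nat \<Rightarrow> nat)) measure"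
  have "indep_set
    (sets (vimage_algebra (space M) (?A \<circ> (\<lambda>\<omega>. restrict (W \<omega>) (noise_at n))) ?S))
    (sets (vimage_algebra (space M) (?B \<circ> (\<lambda>\<omega>. restrict (W \<omega>) (noise_before n)))
      (PiM {..<n} (\<lambda>_. count_space UNIV))))"
  proof (rule indep_var_compose_vimage_algebra[OF indep_var_noise_before_at])
    show "?A \<in> PiM (noise_at n) (\<lambda>_. count_space UNIV) \<rightarrow>\<^sub>M ?S"
      by (intro measurable_Pair measurable_restrict measurable_noise_component)
        (auto simp: measurable_noise_component)
    show "?B \<in> PiM (noise_before n) (\<lambda>_. count_space UNIV) \<rightarrow>\<^sub>M PiM {..<n} (\<lambda>_. count_space UNIV)"
      by (intro measurable_restrict measurable_inar_solution)
  qed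
  also have "?A \<circ> (\<lambda>\<omega>. restrict (W \<omega>) (noise_at n)) =
      (\<lambda>\<omega>. (\<epsilon> n \<omega>, restrict (\<lambda>(k, l). \<xi> n k l \<omega>) ({1..} \<times> {1..})))"
    by (auto simp: fun_eq_iff noise_at_def restrict_def)
  also have "?B \<circ> (\<lambda>\<omega>. restrict (W \<omega>) (noise_before n)) =
      (\<lambda>\<omega>. restrict (\<lambda>m. inar_solution (W \<omega>) m) {..<n})"
    by (auto simp: fun_eq_iff noise_before_def intro!: restrict_ext inar_solution_cong)
  finally show ?thesis .
qed

lemma stationary_inar_solution_inar_solution:
  "stationary_inar_solution \<epsilon> \<xi> (\<lambda>n \<omega>. inar_solution (W \<omega>) n)"
  unfolding stationary_inar_solution_def
proof (intro conjI allI)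
  fix n
  show "AE \<omega> in M. ((\<lambda>k. real (\<Sum>l = 1..inar_solution (W \<omega>) (n - int k). \<xi> n k l \<omega>)) has_sum
      (real (inar_solution (W \<omega>) n) - real (\<epsilon> n \<omega>))) {1..}"
    using AE_limit_finite
  proof eventually_elim
    case (elim \<omega>)
    then show ?case
      using inar_solution_recursion[of "W \<omega>" n] by simp
  qed
qed (rule strictly_stationary_solution indep_set_noise_past)+

section \<open>Mean of the solution and convergence of weighted series\<close>

lemma nn_integral_inar_solution:
  "(\<integral>\<^sup>+\<omega>. of_nat (inar_solution (W \<omega>) n) \<partial>M) = ennreal (\<alpha> 0 / (1 - K))"
proof -
  have "(\<integral>\<^sup>+\<omega>. of_nat (inar_solution (W \<omega>) n) \<partial>M) = (\<integral>\<^sup>+\<omega>. inar_limit (W \<omega>) n \<partial>M)"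
    using AE_limit_finite by (intro nn_integral_cong_AE) (auto simp: inar_solution_eq)
  then show ?thesis by (simp add: nn_integral_limit)
qed

text \<open>By Tonelli the weighted series has expectation equal to the total weight times the
  common mean, so it is finite almost surely. Both \<alpha> and \<beta> will serve as
  weights.\<close>

lemma AE_summable_weighted:
  assumes meas: "\<And>n. X n \<in> M \<rightarrow>\<^sub>M count_space UNIV"
    and mean: "\<And>n. (\<integral>\<^sup>+\<omega>. of_nat (X n \<omega>) \<partial>M) = ennreal (\<alpha> 0 / (1 - K))"
    and c: "summable c" "\<And>k. 0 \<le> c k"
  shows "AE \<omega> in M. summable (\<lambda>k. c k * real (X (t k) \<omega>))"
proof -
  note [measurable] = meas
  have "(\<integral>\<^sup>+\<omega>. (\<Sum>k. ennreal (c k) * of_nat (X (t k) \<omega>)) \<partial>M) = (\<Sum>k. ennreal (c k)) * ennreal (\<alpha> 0 / (1 - K))"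
    by (simp add: nn_integral_suminf nn_integral_cmult mean)
  also have "(\<Sum>k. ennreal (c k)) = ennreal (\<Sum>k. c k)"
    by (rule suminf_ennreal2[OF c(2,1)])
  finally have "(\<integral>\<^sup>+\<omega>. (\<Sum>k. ennreal (c k) * of_nat (X (t k) \<omega>)) \<partial>M) \<noteq> \<infinity>"
    by (simp add: ennreal_mult_eq_top_iff)
  then have "AE \<omega> in M. (\<Sum>k. ennreal (c k) * of_nat (X (t k) \<omega>)) \<noteq> \<infinity>"
    by (intro nn_integral_PInf_AE) simp_all
  then show ?thesis
  proof eventually_elim
    case (elim \<omega>)
    then show ?case
      using c by (intro summable_suminf_not_top) (simp_all add: ennreal_mult ennreal_of_nat_eq_real_of_nat)
  qed
qed

end

theorem proposition2:
  fixes M :: "'w measure"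
    and \<alpha> :: "nat \<Rightarrow> real"
    and K :: real
    and \<epsilon> :: "int \<Rightarrow> 'w \<Rightarrow> nat"
    and \<xi> :: "int \<Rightarrow> nat \<Rightarrow> nat \<Rightarrow> 'w \<Rightarrow> nat"
    and X :: "int \<Rightarrow> 'w \<Rightarrow> nat"
    and \<mu>\<^sub>X :: real
    and u :: "int \<Rightarrow> 'w \<Rightarrow> real"
    and \<beta> :: "nat \<Rightarrow> real"
  assumes "prob_space M"
    and "\<And>k. \<alpha> k \<ge> 0"
    and "(\<lambda>k. \<alpha> (Suc k)) sums K"
    and "K < 1"
    and "prob_space.inar_process M \<alpha> \<epsilon> \<xi> X"
  defines "\<mu>\<^sub>X \<equiv> prob_space.expectation M (\<lambda>\<omega>. real (X 0 \<omega>))"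
    and "u \<equiv> inar_innovation \<alpha> X"
    and "\<beta> \<equiv> inar_beta \<alpha>"
  shows "integrable M (\<lambda>\<omega>. real (X 0 \<omega>)) \<and> \<mu>\<^sub>X = \<alpha> 0 / (1 - K) \<and>
    (\<forall>n. AE \<omega> in M. summable (\<lambda>k. \<alpha> (Suc k) * real (X (n - int (Suc k)) \<omega>))) \<and>
    (\<forall>n. AE \<omega> in M. (\<lambda>k. \<beta> k * u (n - int k) \<omega>) sums (real (X n \<omega>) - \<mu>\<^sub>X)) \<and>
    (\<forall>k. \<beta> k \<ge> 0) \<and>
    \<beta> sums (1 / (1 - K))"
proof -
  interpret prob_space M by fact
  interpret inar_noise_space M \<alpha> \<epsilon> \<xi> K
    using assms(2-5) by unfold_locales (auto simp: inar_process_def)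
  \<comment> \<open>The uniqueness clause identifies \<open>X\<close> with the constructed solution,
    so that \<open>X\<close> inherits its finite mean.\<close>
  have AE_eq: "AE \<omega> in M. \<forall>n. inar_solution (W \<omega>) n = X n \<omega>"
    using assms(5) stationary_inar_solution_inar_solution by (auto simp: inar_process_def)
  have [measurable]: "X n \<in> M \<rightarrow>\<^sub>M count_space UNIV" for n
    using assms(5) by (simp add: inar_process_def stationary_inar_solution_def strictly_stationary_def)
  have mean: "(\<integral>\<^sup>+\<omega>. of_nat (X n \<omega>) \<partial>M) = ennreal (\<alpha> 0 / (1 - K))" for n
    unfolding nn_integral_inar_solution[of n, symmetric]
    using AE_eq by (intro nn_integral_cong_AE) auto
  have mean0: "(\<integral>\<^sup>+\<omega>. ennreal (real (X 0 \<omega>)) \<partial>M) = ennreal (\<alpha> 0 / (1 - K))"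
    using mean[of 0] by (simp add: ennreal_of_nat_eq_real_of_nat)
  have integrable: "integrable M (\<lambda>\<omega>. real (X 0 \<omega>))"
    using mean0 by (intro integrableI_nonneg) auto
  have \<mu>: "\<mu>\<^sub>X = \<alpha> 0 / (1 - K)"
    unfolding \<mu>\<^sub>X_def using \<alpha>_nonneg K_less mean0
    by (subst integral_eq_nn_integral) (auto simp: enn2real_ennreal)
  have \<beta>_nonneg: "\<beta> k \<ge> 0" for k
    unfolding \<beta>_def by (rule inar_beta_nonneg[OF \<alpha>_nonneg])
  have \<beta>_sums: "\<beta> sums (1 / (1 - K))"
    unfolding \<beta>_def by (rule inar_beta_sums[OF \<alpha>_nonneg \<alpha>_sums K_less])
  have summable_\<alpha>: "AE \<omega> in M. summable (\<lambda>k. \<alpha> (Suc k) * real (X (n - int (Suc k)) \<omega>))" for n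
    using \<alpha>_sums \<alpha>_nonneg by (intro AE_summable_weighted mean) (auto simp: sums_iff)
  \<comment> \<open>One null set has to serve all times, since the expansion at \<open>n\<close>
    involves the innovations at \<open>n\<close> and at every earlier time.\<close>
  then have summable_\<alpha>': "AE \<omega> in M. \<forall>n. summable (\<lambda>k. \<alpha> (Suc k) * real (X (n - int (Suc k)) \<omega>))"
    by (simp add: AE_all_countable)
  have "AE \<omega> in M. (\<lambda>k. \<beta> k * u (n - int k) \<omega>) sums (real (X n \<omega>) - \<mu>\<^sub>X)" for n
  proof -
    have "AE \<omega> in M. summable (\<lambda>k. \<beta> k * real (X (n - int k) \<omega>))"
      using \<beta>_sums \<beta>_nonneg by (intro AE_summable_weighted mean) (auto simp: sums_iff)
    with summable_\<alpha>' show ?thesis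
    proof eventually_elim
      case (elim \<omega>)
      \<comment> \<open>Indexing the path backwards from \<open>n\<close> reduces the claim to the
        deterministic identity for nonnegative sequences, applied path by path.\<close>
      define x where "x k = real (X (n - int k) \<omega>)" for k
      have shift: "X (n - int k - int (Suc j)) \<omega> = X (n - int (k + Suc j)) \<omega>" for k j
        by (simp add: algebra_simps)
      have "summable (\<lambda>j. \<alpha> (Suc j) * x (k + Suc j))" for k
        using elim(1)[rule_format, of "n - int k"] unfolding x_def shift .
      then have "(\<lambda>k. \<beta> k * (x k - (\<Sum>j. \<alpha> (Suc j) * x (k + Suc j)))) sums x 0"
        unfolding \<beta>_def using elim(2)
        by (intro inar_beta_moving_average_sums \<alpha>_nonneg) (auto simp: x_def \<beta>_def)
      \<comment> \<open>Subtracting \<open>\<alpha> 0\<close> in every innovation costs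
        \<open>\<alpha> 0\<close> times the total mass of \<beta>, which is exactly the
        mean.\<close>
      from sums_diff[OF this sums_mult2[OF \<beta>_sums, of "\<alpha> 0"]]
      have "(\<lambda>k. \<beta> k * (x k - (\<Sum>j. \<alpha> (Suc j) * x (k + Suc j)) - \<alpha> 0)) sums (x 0 - \<mu>\<^sub>X)"
        by (simp add: \<mu> algebra_simps)
      then show ?case
        unfolding u_def inar_innovation_def shift by (simp add: x_def)
    qed
  qed
  with integrable \<mu> summable_\<alpha> \<beta>_nonneg \<beta>_sums show ?thesis by blast
qed

end
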